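(* Let $\sigma\in S_m$ and $\tau\in S_n$, and let $\beta\vDash m$ and $\gamma\vDash n$ be compositions. If $d(\sigma)=S(\beta)$ and $d(\tau)=S(\gamma)$, then $d(\sigma\otimes\tau)=S(\beta\circ\gamma)$.
   Context: A composition $\beta\vDash n$ is a finite list $\beta_1\cdots\beta_k$ of positive integers with sum $n$; $S(\beta)=\{\beta_1,\beta_1+\beta_2,\dots,\beta_1+\cdots+\beta_{k-1}\}\subseteq[n-1]$. For $\sigma\in S_n$, the descent set is $d(\sigma)=\{i\mid\sigma(i)>\sigma(i+1)\}\subseteq[n-1]$. For $\sigma\in S_m$, $\tau\in S_n$, the tensor product $\sigma\otimes\tau\in S_{mn}$ is the permutation given in one-line notation by $(\sigma\otimes\tau)((i-1)n+j)=(\sigma(i)-1)n+\tau(j)$ for $1\le i\le m$, $1\le j\le n$. For $\alpha=\alpha_1\cdots\alpha_k$ and $\beta=\beta_1\cdots\beta_l$: $\alpha\cdot\beta=\alpha_1\cdots\alpha_k\beta_1\cdots\beta_l$, $\alpha\odot\beta=\alpha_1\cdots\alpha_{k-1}(\alpha_k+\beta_1)\beta_2\cdots\beta_l$, $\beta^{\odot n}=\beta\odot\cdots\odot\beta$ ($n$ factors), and $\alpha\circ\beta=\beta^{\odot\alpha_1}\cdot\beta^{\odot\alpha_2}\cdots\beta^{\odot\alpha_k}$. *)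

theory Defs
  imports "HOL-Combinatorics.Permutations"
begin

definition is_composition :: "nat list \<Rightarrow> nat \<Rightarrow> bool" where
  "is_composition \<beta> n \<longleftrightarrow> (\<forall>b\<in>set \<beta>. 0 < b) \<and> sum_list \<beta> = n"

definition comp_set :: "nat list \<Rightarrow> nat set" where
  "comp_set \<beta> = {sum_list (take i \<beta>) | i. 1 \<le> i \<and> i < length \<beta>}"

text \<open>
  An element of the symmetric group on \<open>{1..n}\<close> is a function \<open>\<sigma>\<close> with \<open>\<sigma> permutes {1..n}\<close>.
  Such a function does not determine \<open>n\<close>, so the degree is an explicit argument below.
\<close>

definition descent_set :: "nat \<Rightarrow> (nat \<Rightarrow> nat) \<Rightarrow> nat set" where
  "descent_set n \<sigma> = {i. 1 \<le> i \<and> i < n \<and> \<sigma> i > \<sigma> (i + 1)}"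

text \<open>
  A position \<open>k\<close> in \<open>{1..m * n}\<close> is uniquely \<open>(i - 1) * n + j\<close> with \<open>i\<close> in \<open>{1..m}\<close> and
  \<open>j\<close> in \<open>{1..n}\<close>, namely \<open>i = (k - 1) div n + 1\<close> and \<open>j = (k - 1) mod n + 1\<close>.
  Outside \<open>{1..m * n}\<close> the function is the identity, as \<open>permutes\<close> requires.
  The lemma \<open>perm_tensor_apply\<close> gives the usual one-line formula.
\<close>

definition perm_tensor :: "nat \<Rightarrow> nat \<Rightarrow> (nat \<Rightarrow> nat) \<Rightarrow> (nat \<Rightarrow> nat) \<Rightarrow> nat \<Rightarrow> nat" where
  "perm_tensor m n \<sigma> \<tau> k =
     (if 1 \<le> k \<and> k \<le> m * n
      then (\<sigma> ((k - 1) div n + 1) - 1) * n + \<tau> ((k - 1) mod n + 1)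
      else k)"

lemma block_position:
  fixes i j m n :: nat
  assumes "1 \<le> i" "i \<le> m" "1 \<le> j" "j \<le> n"
  shows "1 \<le> (i - 1) * n + j" "(i - 1) * n + j \<le> m * n"
    "((i - 1) * n + j - 1) div n = i - 1" "((i - 1) * n + j - 1) mod n = j - 1"
proof -
  have eq: "(i - 1) * n + j - 1 = (j - 1) + (i - 1) * n" and "j - 1 < n" "0 < n"
    using assms by auto
  show "1 \<le> (i - 1) * n + j" using assms by simp
  have "(i - 1) * n + j \<le> (i - 1) * n + n" using assms by simp
  also have "\<dots> = i * n" using assms by (cases i) auto
  also have "\<dots> \<le> m * n" using assms by simp
  finally show "(i - 1) * n + j \<le> m * n" .
  show "((i - 1) * n + j - 1) div n = i - 1" "((i - 1) * n + j - 1) mod n = j - 1"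
    unfolding eq using \<open>j - 1 < n\<close> \<open>0 < n\<close> by simp_all
qed

lemma perm_tensor_apply:
  assumes "1 \<le> i" "i \<le> m" "1 \<le> j" "j \<le> n"
  shows "perm_tensor m n \<sigma> \<tau> ((i - 1) * n + j) = (\<sigma> i - 1) * n + \<tau> j"
  using block_position[OF assms] assms by (simp add: perm_tensor_def)

lemma block_decomp:
  fixes k m n :: nat
  assumes "1 \<le> k" "k \<le> m * n"
  obtains i j where "1 \<le> i" "i \<le> m" "1 \<le> j" "j \<le> n" "k = (i - 1) * n + j"
proof
  have n: "0 < n" using assms by (cases n) auto
  show "1 \<le> (k - 1) div n + 1" "1 \<le> (k - 1) mod n + 1" by simp_all
  have "k - 1 < m * n" using assms by simp
  then have "(k - 1) div n < m" using n by (simp add: div_less_iff_less_mult)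
  then show "(k - 1) div n + 1 \<le> m" by simp
  show "(k - 1) mod n + 1 \<le> n" using n by (simp add: Suc_le_eq)
  have "(k - 1) div n * n + (k - 1) mod n = k - 1" by (rule div_mult_mod_eq)
  then show "k = ((k - 1) div n + 1 - 1) * n + ((k - 1) mod n + 1)"
    using assms by simp
qed

lemma perm_tensor_permutes:
  assumes s: "\<sigma> permutes {1..m}" and t: "\<tau> permutes {1..n}"
  shows "perm_tensor m n \<sigma> \<tau> permutes {1..m * n}"
proof (rule bij_imp_permutes)
  let ?f = "perm_tensor m n \<sigma> \<tau>"
  have rs: "1 \<le> \<sigma> i" "\<sigma> i \<le> m" if "1 \<le> i" "i \<le> m" for i
    using permutes_in_image[OF s, of i] that by auto
  have rt: "1 \<le> \<tau> i" "\<tau> i \<le> n" if "1 \<le> i" "i \<le> n" for i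
    using permutes_in_image[OF t, of i] that by auto
  have sub: "?f ` {1..m * n} \<subseteq> {1..m * n}"
  proof
    fix y assume "y \<in> ?f ` {1..m * n}"
    then obtain k where k: "1 \<le> k" "k \<le> m * n" "y = ?f k" by auto
    obtain i j where ij: "1 \<le> i" "i \<le> m" "1 \<le> j" "j \<le> n" "k = (i - 1) * n + j"
      by (rule block_decomp[OF k(1,2)])
    show "y \<in> {1..m * n}"
      using block_position[OF rs[OF ij(1,2)] rt[OF ij(3,4)]] perm_tensor_apply[OF ij(1-4)] k(3) ij(5)
      by auto
  qed
  have inj: "inj_on ?f {1..m * n}"
  proof (rule inj_onI)
    fix k k' assume a: "k \<in> {1..m * n}" "k' \<in> {1..m * n}" "?f k = ?f k'"
    obtain i j where ij: "1 \<le> i" "i \<le> m" "1 \<le> j" "j \<le> n" "k = (i - 1) * n + j"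
      by (rule block_decomp[of k m n]) (use a in auto)
    obtain i' j' where ij': "1 \<le> i'" "i' \<le> m" "1 \<le> j'" "j' \<le> n" "k' = (i' - 1) * n + j'"
      by (rule block_decomp[of k' m n]) (use a in auto)
    have e: "(\<sigma> i - 1) * n + \<tau> j = (\<sigma> i' - 1) * n + \<tau> j'"
      using a(3) perm_tensor_apply[OF ij(1-4)] perm_tensor_apply[OF ij'(1-4)] ij(5) ij'(5) by metis
    note p = block_position[OF rs[OF ij(1,2)] rt[OF ij(3,4)]]
    note p' = block_position[OF rs[OF ij'(1,2)] rt[OF ij'(3,4)]]
    have "\<sigma> i - 1 = \<sigma> i' - 1" "\<tau> j - 1 = \<tau> j' - 1"
      using p(3,4) p'(3,4) unfolding e by simp_all
    then have "\<sigma> i = \<sigma> i'" "\<tau> j = \<tau> j'"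
      using rs[OF ij(1,2)] rs[OF ij'(1,2)] rt[OF ij(3,4)] rt[OF ij'(3,4)] by auto
    then have "i = i'" "j = j'"
      using permutes_inj[OF s] permutes_inj[OF t] by (auto dest: injD)
    then show "k = k'" using ij(5) ij'(5) by simp
  qed
  show "bij_betw ?f {1..m * n} {1..m * n}"
    using inj sub endo_inj_surj[of "{1..m * n}" ?f] by (simp add: bij_betw_def)
next
  fix k assume "k \<notin> {1..m * n}"
  then show "perm_tensor m n \<sigma> \<tau> k = k" by (auto simp: perm_tensor_def)
qed

text \<open>
  The usual definition of near-concatenation needs both arguments nonempty;
  the empty composition (of 0) is taken to be its unit.
\<close>

definition near_concat :: "nat list \<Rightarrow> nat list \<Rightarrow> nat list" where
  "near_concat \<alpha> \<beta> =
     (if \<alpha> = [] then \<beta> else if \<beta> = [] then \<alpha>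
      else butlast \<alpha> @ [last \<alpha> + hd \<beta>] @ tl \<beta>)"

primrec near_power :: "nat list \<Rightarrow> nat \<Rightarrow> nat list" where
  "near_power \<beta> 0 = []"
| "near_power \<beta> (Suc r) = near_concat \<beta> (near_power \<beta> r)"

definition comp_compose :: "nat list \<Rightarrow> nat list \<Rightarrow> nat list" where
  "comp_compose \<alpha> \<beta> = concat (map (near_power \<beta>) \<alpha>)"

end

theory Submission
  imports Defs
begin

text \<open>
  Cut \<open>{1..m * n}\<close> into \<open>m\<close> consecutive blocks of length \<open>n\<close>.  Inside a block,
  \<open>\<sigma> \<otimes> \<tau>\<close> is \<open>\<tau>\<close> shifted by a constant, so its descents there are a translate of \<open>d(\<tau>)\<close>.
  At the boundary between the \<open>i\<close>-th block and the next, the values lie in the value blocks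
  numbered \<open>\<sigma> i\<close> and \<open>\<sigma> (i + 1)\<close>; these are different blocks, so their order decides,
  and \<open>i * n\<close> is a descent iff \<open>i \<in> d(\<sigma>)\<close>.  Hence \<open>d(\<sigma> \<otimes> \<tau>)\<close> consists of \<open>m\<close> translates
  of \<open>d(\<tau>)\<close> together with \<open>n\<close> times \<open>d(\<sigma>)\<close> (lemma \<open>descent_set_perm_tensor\<close>).

  The composition \<open>\<beta> \<circ> \<gamma>\<close> has the same shape.  Near-concatenation translates the second
  partial-sum set behind the first one without adding a point at the junction, while
  concatenation also adds the junction.  So the \<open>m\<close> copies of \<open>\<gamma>\<close> contribute \<open>m\<close> translates
  of \<open>S(\<gamma>)\<close>, and a junction between two copies is added exactly where a part of \<open>\<beta>\<close> ends,
  at \<open>n\<close> times an element of \<open>S(\<beta>)\<close> (lemma \<open>comp_set_comp_compose\<close>).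
\<close>

section \<open>Descents of a tensor product\<close>

lemma permutes_atLeastAtMost_bounds:
  fixes \<sigma> :: "nat \<Rightarrow> nat"
  assumes "\<sigma> permutes {1..m}" "1 \<le> i" "i \<le> m"
  shows "1 \<le> \<sigma> i" "\<sigma> i \<le> m"
  using permutes_in_image[OF assms(1), of i] assms by auto

lemma block_less_iff:
  fixes a b n s t :: nat
  assumes "a \<noteq> b" "1 \<le> a" "1 \<le> b" "1 \<le> s" "s \<le> n" "1 \<le> t" "t \<le> n"
  shows "(a - 1) * n + s < (b - 1) * n + t \<longleftrightarrow> a < b"
proof -
  have less: "(x - 1) * n + u < (y - 1) * n + v"
    if "x < y" "1 \<le> x" "u \<le> n" "1 \<le> v" for x y u v
  proof -
    have "(x - 1) * n + u \<le> x * n" using that by (cases x) auto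
    also have "\<dots> \<le> (y - 1) * n" using that by (intro mult_le_mono1) simp
    finally show ?thesis using that by simp
  qed
  from assms(1) consider "a < b" | "b < a" by linarith
  then show ?thesis
    by cases (use less[of a b s t] less[of b a t s] assms in auto)
qed

lemma perm_tensor_descent_inside:
  assumes "1 \<le> i" "i \<le> m" "1 \<le> j" "j < n"
  shows "perm_tensor m n \<sigma> \<tau> ((i - 1) * n + j + 1) < perm_tensor m n \<sigma> \<tau> ((i - 1) * n + j)
    \<longleftrightarrow> \<tau> (j + 1) < \<tau> j"
  using perm_tensor_apply[of i m j n \<sigma> \<tau>] perm_tensor_apply[of i m "j + 1" n \<sigma> \<tau>] assms
  by simp

text \<open>
  The two values lie in the value blocks \<open>\<sigma> i \<noteq> \<sigma> (i + 1)\<close>, so \<open>\<tau>\<close> has no influence on their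
  order beyond staying within \<open>{1..n}\<close>.
\<close>
lemma perm_tensor_descent_boundary:
  assumes \<sigma>: "\<sigma> permutes {1..m}" and \<tau>: "\<tau> permutes {1..n}"
    and i: "1 \<le> i" "i < m" and n: "0 < n"
  shows "perm_tensor m n \<sigma> \<tau> (i * n + 1) < perm_tensor m n \<sigma> \<tau> (i * n) \<longleftrightarrow> \<sigma> (i + 1) < \<sigma> i"
proof -
  have "i * n = (i - 1) * n + n" using i by (cases i) auto
  then have last: "perm_tensor m n \<sigma> \<tau> (i * n) = (\<sigma> i - 1) * n + \<tau> n"
    using perm_tensor_apply[of i m n n \<sigma> \<tau>] i n by simp
  have first: "perm_tensor m n \<sigma> \<tau> (i * n + 1) = (\<sigma> (i + 1) - 1) * n + \<tau> 1"
    using perm_tensor_apply[of "i + 1" m 1 n \<sigma> \<tau>] i n by simp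
  have "\<sigma> (i + 1) \<noteq> \<sigma> i"
    using injD[OF permutes_inj[OF \<sigma>], of "i + 1" i] by auto
  then show ?thesis
    unfolding last first
    using i n permutes_atLeastAtMost_bounds[OF \<sigma>] permutes_atLeastAtMost_bounds[OF \<tau>]
    by (intro block_less_iff) auto
qed

text \<open>
  For \<open>n = 0\<close> the tensor product is the empty permutation, but the image on the right
  contains \<open>0\<close> as soon as \<open>\<sigma>\<close> has a descent.
\<close>
lemma descent_set_perm_tensor:
  assumes \<sigma>: "\<sigma> permutes {1..m}" and \<tau>: "\<tau> permutes {1..n}" and n: "0 < n"
  shows "descent_set (m * n) (perm_tensor m n \<sigma> \<tau>)
    = (\<Union>q<m. (+) (q * n) ` descent_set n \<tau>) \<union> (\<lambda>i. i * n) ` descent_set m \<sigma>"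
    (is "?L = ?R")
proof (intro equalityI subsetI)
  fix k assume k: "k \<in> ?L"
  then have "1 \<le> k" "k \<le> m * n" by (auto simp: descent_set_def)
  then obtain i j where ij: "1 \<le> i" "i \<le> m" "1 \<le> j" "j \<le> n" "k = (i - 1) * n + j"
    by (rule block_decomp)
  show "k \<in> ?R"
  proof (cases "j = n")
    case True
    then have keq: "k = i * n" using ij by (cases i) auto
    then have im: "i < m" using k by (auto simp: descent_set_def)
    have "i \<in> descent_set m \<sigma>"
      using k perm_tensor_descent_boundary[OF \<sigma> \<tau> ij(1) im n] ij(1) im
      by (simp add: descent_set_def keq)
    then show ?thesis using keq by blast
  next
    case False
    then have "j < n" using ij by simp
    then have "j \<in> descent_set n \<tau>"
      using k perm_tensor_descent_inside[OF ij(1-3), of n \<sigma> \<tau>] ij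
      by (simp add: descent_set_def)
    moreover have "i - 1 < m" using ij by simp
    ultimately show ?thesis using ij(5) by blast
  qed
next
  fix k assume "k \<in> ?R"
  then consider (inside) q j where "q < m" "j \<in> descent_set n \<tau>" "k = q * n + j"
    | (boundary) i where "i \<in> descent_set m \<sigma>" "k = i * n" by blast
  then show "k \<in> ?L"
  proof cases
    case inside
    then have j: "1 \<le> j" "j < n" "\<tau> (j + 1) < \<tau> j" by (auto simp: descent_set_def)
    have "(q + 1) * n \<le> m * n" using inside by (intro mult_le_mono1) simp
    then have "k < m * n" using inside j by simp
    then show ?thesis
      using perm_tensor_descent_inside[of "q + 1" m j n \<sigma> \<tau>] inside j
      by (simp add: descent_set_def)
  next
    case boundary
    then have i: "1 \<le> i" "i < m" "\<sigma> (i + 1) < \<sigma> i" by (auto simp: descent_set_def)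
    then show ?thesis
      using perm_tensor_descent_boundary[OF \<sigma> \<tau> i(1,2) n] boundary n
      by (simp add: descent_set_def Suc_le_eq)
  qed
qed

section \<open>Partial sums of concatenations\<close>

lemma comp_set_Nil [simp]: "comp_set [] = {}"
  by (simp add: comp_set_def)

lemma comp_set_Cons:
  "comp_set (x # xs) = (if xs = [] then {} else insert x ((+) x ` comp_set xs))"
proof (cases "xs = []")
  case False
  have "y \<in> comp_set (x # xs) \<longleftrightarrow> y = x \<or> y \<in> (+) x ` comp_set xs" for y
  proof
    assume "y \<in> comp_set (x # xs)"
    then obtain i where i: "y = sum_list (take i (x # xs))" "1 \<le> i" "i < length (x # xs)"
      by (auto simp: comp_set_def)
    show "y = x \<or> y \<in> (+) x ` comp_set xs"
    proof (cases "i = 1")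
      case True
      then show ?thesis using i by simp
    next
      case False
      then have "y = x + sum_list (take (i - 1) xs)" "1 \<le> i - 1" "i - 1 < length xs"
        using i by (auto simp: take_Cons')
      then show ?thesis unfolding comp_set_def by blast
    qed
  next
    assume "y = x \<or> y \<in> (+) x ` comp_set xs"
    then consider "y = x" | i where "y = x + sum_list (take i xs)" "1 \<le> i" "i < length xs"
      by (auto simp: comp_set_def)
    then show "y \<in> comp_set (x # xs)"
    proof cases
      case 1
      then have "y = sum_list (take 1 (x # xs))" "1 < length (x # xs)" using False by auto
      then show ?thesis unfolding comp_set_def by blast
    next
      case 2
      then have "y = sum_list (take (Suc i) (x # xs))" "1 \<le> Suc i" "Suc i < length (x # xs)"
        by auto
      then show ?thesis unfolding comp_set_def by blast
    qed
  qed
  then show ?thesis using False by auto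
qed (simp add: comp_set_def)

lemma comp_set_append:
  assumes "xs \<noteq> []" "ys \<noteq> []"
  shows "comp_set (xs @ ys)
    = comp_set xs \<union> insert (sum_list xs) ((+) (sum_list xs) ` comp_set ys)"
  using assms(1)
proof (induction xs rule: list_nonempty_induct)
  case (single x)
  then show ?case using assms(2) by (simp add: comp_set_Cons)
next
  case (cons x xs)
  then show ?case by (auto simp: comp_set_Cons image_Un image_image add.assoc)
qed

lemma near_concat_Nil_right [simp]: "near_concat xs [] = xs"
  by (simp add: near_concat_def)

lemma near_concat_single [simp]: "near_concat [x] (y # ys) = (x + y) # ys"
  by (simp add: near_concat_def)

lemma near_concat_Cons [simp]:
  "xs \<noteq> [] \<Longrightarrow> near_concat (x # xs) ys = x # near_concat xs ys"
  by (simp add: near_concat_def)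

lemma near_concat_eq_Nil_iff [simp]: "near_concat xs ys = [] \<longleftrightarrow> xs = [] \<and> ys = []"
  by (auto simp: near_concat_def)

lemma sum_list_near_concat [simp]: "sum_list (near_concat xs ys) = sum_list xs + sum_list ys"
proof (induction xs)
  case (Cons x xs)
  then show ?case by (cases "xs = []"; cases ys) auto
qed (simp add: near_concat_def)

text \<open>
  In contrast to \<open>comp_set_append\<close>, merging the two parts at the junction removes the partial
  sum \<open>sum_list xs\<close>.
\<close>
lemma comp_set_near_concat:
  "comp_set (near_concat xs ys) = comp_set xs \<union> (+) (sum_list xs) ` comp_set ys"
proof (induction xs)
  case (Cons x xs)
  show ?case
  proof (cases "xs = []")
    case True
    then show ?thesis by (cases ys) (auto simp: comp_set_Cons image_image add.assoc)
  next
    case False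
    then show ?thesis using Cons by (auto simp: comp_set_Cons image_Un image_image add.assoc)
  qed
qed (simp add: near_concat_def)

section \<open>Partial sums of a composite\<close>

lemma sum_list_near_power [simp]: "sum_list (near_power \<gamma> r) = r * sum_list \<gamma>"
  by (induction r) auto

lemma near_power_eq_Nil_iff [simp]: "near_power \<gamma> r = [] \<longleftrightarrow> \<gamma> = [] \<or> r = 0"
  by (induction r) auto

lemma translates_add:
  fixes A :: "nat set"
  shows "(\<Union>q<a + b. (+) (q * n) ` A)
    = (\<Union>q<a. (+) (q * n) ` A) \<union> (+) (a * n) ` (\<Union>q<b. (+) (q * n) ` A)"
proof -
  have "{..<a + b} = {..<a} \<union> (+) a ` {..<b}"
    by (simp add: image_add_atLeastLessThan lessThan_atLeast0 ivl_disj_un add.commute)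
  then show ?thesis
    by (simp add: UN_Un image_UN image_image add.assoc algebra_simps)
qed

lemma comp_set_near_power:
  "comp_set (near_power \<gamma> r) = (\<Union>q<r. (+) (q * sum_list \<gamma>) ` comp_set \<gamma>)"
proof (induction r)
  case (Suc r)
  have "(\<Union>q<1 + r. (+) (q * sum_list \<gamma>) ` comp_set \<gamma>)
    = comp_set \<gamma> \<union> (+) (sum_list \<gamma>) ` comp_set (near_power \<gamma> r)"
    unfolding translates_add Suc by (simp add: lessThan_Suc)
  then show ?case by (simp add: comp_set_near_concat)
qed simp

lemma comp_compose_Cons: "comp_compose (b # \<beta>) \<gamma> = near_power \<gamma> b @ comp_compose \<beta> \<gamma>"
  by (simp add: comp_compose_def)

text \<open>
  The induction splits off the first part \<open>b\<close> of \<open>\<beta>\<close>: it contributes the first \<open>b\<close> translates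
  of \<open>S(\<gamma>)\<close>, and the junction behind it lies at \<open>b\<close> times the sum of \<open>\<gamma>\<close>.  If \<open>b = 0\<close> or \<open>\<gamma> = []\<close>,
  the factor \<open>near_power \<gamma> b\<close> would be empty and create no junction.
\<close>
lemma comp_set_comp_compose:
  assumes "\<forall>b\<in>set \<beta>. 0 < b" "\<gamma> \<noteq> []"
  shows "comp_set (comp_compose \<beta> \<gamma>)
    = (\<Union>q<sum_list \<beta>. (+) (q * sum_list \<gamma>) ` comp_set \<gamma>)
      \<union> (\<lambda>i. i * sum_list \<gamma>) ` comp_set \<beta>"
  using assms(1)
proof (induction \<beta>)
  case Nil
  show ?case by (simp add: comp_compose_def)
next
  case (Cons b \<beta>)
  show ?case
  proof (cases "\<beta> = []")
    case True
    then show ?thesis by (simp add: comp_compose_def comp_set_near_power comp_set_Cons)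
  next
    case False
    then have "comp_compose \<beta> \<gamma> \<noteq> []"
      using Cons.prems assms(2) by (cases \<beta>) (auto simp: comp_compose_def)
    moreover have "near_power \<gamma> b \<noteq> []" using Cons.prems assms(2) by simp
    ultimately have "comp_set (comp_compose (b # \<beta>) \<gamma>) = comp_set (near_power \<gamma> b)
        \<union> insert (b * sum_list \<gamma>) ((+) (b * sum_list \<gamma>) ` comp_set (comp_compose \<beta> \<gamma>))"
      by (simp add: comp_compose_Cons comp_set_append)
    also have "(+) (b * sum_list \<gamma>) ` comp_set (comp_compose \<beta> \<gamma>)
      = (+) (b * sum_list \<gamma>) ` (\<Union>q<sum_list \<beta>. (+) (q * sum_list \<gamma>) ` comp_set \<gamma>)
        \<union> (\<lambda>i. (b + i) * sum_list \<gamma>) ` comp_set \<beta>"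
      using Cons by (simp add: image_Un image_image algebra_simps)
    finally show ?thesis
      using False
      by (simp only: comp_set_near_power comp_set_Cons sum_list.Cons translates_add
          image_insert image_image if_False Un_insert_left Un_insert_right Un_assoc)
  qed
qed

theorem proposition3p2:
  fixes m n :: nat and \<sigma> \<tau> :: "nat \<Rightarrow> nat" and \<beta> \<gamma> :: "nat list"
  assumes "\<sigma> permutes {1..m}" and "\<tau> permutes {1..n}"
    and "is_composition \<beta> m" and "is_composition \<gamma> n"
    and "descent_set m \<sigma> = comp_set \<beta>"
    and "descent_set n \<tau> = comp_set \<gamma>"
  shows "descent_set (m * n) (perm_tensor m n \<sigma> \<tau>) = comp_set (comp_compose \<beta> \<gamma>)"
proof (cases "\<gamma> = []")
  case True
  \<comment> \<open>Then \<open>n = 0\<close>, and both sides are empty.\<close>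
  then have "n = 0" using assms(4) by (simp add: is_composition_def)
  moreover have "comp_compose \<beta> [] = []" by (auto simp: comp_compose_def)
  ultimately show ?thesis using True by (simp add: descent_set_def)
next
  case False
  then have "0 < n" using assms(4) by (cases \<gamma>) (auto simp: is_composition_def)
  then show ?thesis
    using descent_set_perm_tensor[OF assms(1,2)] comp_set_comp_compose[of \<beta> \<gamma>] False assms(3-6)
    by (simp add: is_composition_def)
qed

end
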